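(* Let $\mathcal{H}$ be a complex Hilbert space, $T,A\in\mathcal{B}(\mathcal{H})$, $x,y\in\mathcal{H}$, and let $A$ be invertible such that $T$ is similar to $x\otimes y$ by $A$, i.e. $AT=(x\otimes y)A$. Then for $S\in\mathcal{B}(\mathcal{H})$ the following are equivalent: (i) $S\in\mathcal{D}_T$; (ii) $A^{-1}x\otimes A^*y$ majorizes $A^{-1}x\otimes S^*A^*y$; (iii) there exists $M>0$ such that $|\langle z,S^*A^*y\rangle|\le M|\langle z,A^*y\rangle|$ for all $z\in\mathcal{H}$. Moreover, $$\mathcal{B}_T=\{S\in\mathcal{B}(\mathcal{H}): A^*y \text{ is an eigenvector for } S^*\}.$$
   Context: $\mathcal{B}(\mathcal{H})$ is the algebra of all bounded linear operators on $\mathcal{H}$. For $x,y\in\mathcal{H}$, $x\otimes y\in\mathcal{B}(\mathcal{H})$ is the operator $(x\otimes y)h=\langle h,y\rangle x$. For $T,S\in\mathcal{B}(\mathcal{H})$, $T$ majorizes $S$ if there is $M>0$ with $\|Sx\|\le M\|Tx\|$ for all $x\in\mathcal{H}$. For $T\in\mathcal{B}(\mathcal{H})$ the Deddens algebra $\mathcal{D}_T$ is the set of all $S\in\mathcal{B}(\mathcal{H})$ for which there is $M>0$ with $\|T^nSx\|\le M\|T^nx\|$ for all $n\in\mathbb{N}$ and $x\in\mathcal{H}$. Let $r(T)$ be the spectral radius of $T$; for integers $m\ge1$ put $d_m=\frac{1}{1/m+r(T)}$ and $R_m=\left(\sum_{n=0}^{\infty}d_m^{2n}T^{*n}T^n\right)^{1/2}$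 (the series converges in norm and $R_m$ is positive and invertible). The spectral radius algebra $\mathcal{B}_T$ is the set of all $S\in\mathcal{B}(\mathcal{H})$ with $\sup_{m\in\mathbb{N}}\|R_mSR_m^{-1}\|<\infty$.
   Formalization: The equivalence of (ii) and (iii) is stated for x ≠ 0 and the formula for B_T for x, y ≠ 0; if x = 0 ≠ y and dim H ≥ 2, (iii) and the formula fail, and if y = 0 then B_T = B(H) while the right-hand side is empty. *)

theory Defs
  imports "HOL-Analysis.Analysis"
begin

section \<open>Complex Hilbert spaces\<close>

text \<open>The inner product is linear in its \<^emph>\<open>first\<close> argument. The superclass \<^class>\<open>banach\<close> supplies
  the real scalar multiplication, the norm and completeness; two axioms tie them to the complex
  structure.\<close>

class complex_hilbert = banach +
  fixes scaleC :: "complex \<Rightarrow> 'a \<Rightarrow> 'a" (infixr "*\<^sub>C" 75)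
    and cinner :: "'a \<Rightarrow> 'a \<Rightarrow> complex" ("\<langle>_,/ _\<rangle>")
  assumes scaleR_eq_scaleC: "r *\<^sub>R x = complex_of_real r *\<^sub>C x"
    and scaleC_add_right: "a *\<^sub>C (x + y) = a *\<^sub>C x + a *\<^sub>C y"
    and scaleC_add_left: "(a + b) *\<^sub>C x = a *\<^sub>C x + b *\<^sub>C x"
    and scaleC_scaleC: "a *\<^sub>C (b *\<^sub>C x) = (a * b) *\<^sub>C x"
    and scaleC_one: "1 *\<^sub>C x = x"
    and cinner_add_left: "\<langle>x + y, z\<rangle> = \<langle>x, z\<rangle> + \<langle>y, z\<rangle>"
    and cinner_scaleC_left: "\<langle>a *\<^sub>C x, y\<rangle> = a * \<langle>x, y\<rangle>"
    and cinner_commute: "\<langle>x, y\<rangle> = cnj \<langle>y, x\<rangle>"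
    and cinner_self: "\<langle>x, x\<rangle> = complex_of_real ((norm x)\<^sup>2)"

instantiation complex :: complex_hilbert
begin
definition scaleC_complex :: "complex \<Rightarrow> complex \<Rightarrow> complex" where "scaleC_complex a x = a * x"
definition cinner_complex :: "complex \<Rightarrow> complex \<Rightarrow> complex" where "cinner_complex x y = x * cnj y"
instance
  by standard (auto simp: scaleC_complex_def cinner_complex_def scaleR_conv_of_real
      algebra_simps complex_norm_square simp del: of_real_power)
end

lemma cmod_mult_cnj: "z * cnj z = (complex_of_real (cmod z))\<^sup>2"
  using complex_norm_square[of z] by simp

lemma norm_scaleC: "norm (a *\<^sub>C x) = cmod a * norm (x :: 'a::complex_hilbert)"
proof -
  have "complex_of_real ((norm (a *\<^sub>C x))\<^sup>2) = a * cnj (a * \<langle>x, x\<rangle>)"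
    using cinner_self[of "a *\<^sub>C x"] cinner_commute[of x "a *\<^sub>C x"]
    by (metis cinner_scaleC_left)
  also have "\<dots> = complex_of_real ((cmod a * norm x)\<^sup>2)"
    by (simp add: cinner_self power_mult_distrib cmod_mult_cnj)
  finally have "(norm (a *\<^sub>C x))\<^sup>2 = (cmod a * norm x)\<^sup>2"
    by (simp only: of_real_eq_iff)
  then show ?thesis
    by (simp add: power2_eq_iff_nonneg)
qed

lemma cinner_Cauchy_Schwarz: "cmod \<langle>x, y\<rangle> \<le> norm x * norm (y :: 'a::complex_hilbert)"
proof (cases "y = 0")
  case True
  have "\<langle>x, y\<rangle> = cnj ((0 :: complex) * \<langle>x, x\<rangle>)"
    using cinner_commute[of x y] cinner_scaleC_left[of 0 x x] True
      scaleR_eq_scaleC[of 0 x] by simp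
  then show ?thesis using True by simp
next
  case False
  define c where "c = \<langle>x, y\<rangle>"
  define N where "N = complex_of_real ((norm y)\<^sup>2)"
  define p where "p = N *\<^sub>C x"
  define q where "q = (- c) *\<^sub>C y"
  have add_right: "\<langle>u, v + w\<rangle> = \<langle>u, v\<rangle> + \<langle>u, w\<rangle>" for u v w :: 'a
    using cinner_add_left[of v w u] cinner_commute[of u "v + w"]
      cinner_commute[of u v] cinner_commute[of u w] by (simp only: complex_cnj_add)
  have scale_right: "\<langle>u, b *\<^sub>C v\<rangle> = cnj b * \<langle>u, v\<rangle>" for u v :: 'a and b
    using cinner_scaleC_left[of b v u] cinner_commute[of u "b *\<^sub>C v"]
      cinner_commute[of u v] by (simp only: complex_cnj_mult)
  have cyx: "\<langle>y, x\<rangle> = cnj c" unfolding c_def by (rule cinner_commute)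
  have cnjN: "cnj N = N" by (simp add: N_def)
  have "complex_of_real ((norm (p + q))\<^sup>2) = \<langle>p + q, p + q\<rangle>"
    by (simp only: cinner_self)
  also have "\<dots> = N * (N * complex_of_real ((norm x)\<^sup>2) - c * cnj c)"
    unfolding p_def q_def cinner_add_left add_right cinner_scaleC_left scale_right cyx
      c_def[symmetric] cinner_self[of y, folded N_def] cinner_self[of x] cnjN complex_cnj_minus
    by (simp add: algebra_simps del: of_real_power)
  also have "\<dots> = complex_of_real ((norm y)\<^sup>2 * ((norm y)\<^sup>2 * (norm x)\<^sup>2 - (cmod c)\<^sup>2))"
    by (simp add: N_def cmod_mult_cnj)
  finally have "(norm (p + q))\<^sup>2 = (norm y)\<^sup>2 * ((norm y)\<^sup>2 * (norm x)\<^sup>2 - (cmod c)\<^sup>2)"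
    by (simp only: of_real_eq_iff)
  then have "0 \<le> (norm y)\<^sup>2 * ((norm y)\<^sup>2 * (norm x)\<^sup>2 - (cmod c)\<^sup>2)"
    using zero_le_power2[of "norm (p + q)"] by (simp only:)
  then have "0 \<le> (norm y)\<^sup>2 * (norm x)\<^sup>2 - (cmod c)\<^sup>2"
    using False by (simp only: zero_le_mult_iff) simp
  then have "(cmod c)\<^sup>2 \<le> (norm x * norm y)\<^sup>2"
    by (simp add: power_mult_distrib mult.commute)
  then show ?thesis
    unfolding c_def by (rule power2_le_imp_le) simp
qed


section \<open>Bounded operators\<close>

text \<open>The library type \<open>'a \<Rightarrow>\<^sub>L 'a\<close> consists of the bounded \<^emph>\<open>real\<close>-linear maps, with the operator
  norm; the algebra of bounded operators of the Hilbert space is its complex-linear part.\<close>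

definition bounded_ops :: "('a::complex_hilbert \<Rightarrow>\<^sub>L 'a) set" where
  "bounded_ops = {T. \<forall>a x. blinfun_apply T (a *\<^sub>C x) = a *\<^sub>C blinfun_apply T x}"

lift_definition op_scaleC :: "complex \<Rightarrow> ('a::complex_hilbert \<Rightarrow>\<^sub>L 'a) \<Rightarrow> ('a \<Rightarrow>\<^sub>L 'a)"
  is "\<lambda>a T x. a *\<^sub>C T x"
proof -
  fix a :: complex and T :: "'a \<Rightarrow> 'a"
  assume "bounded_linear T"
  then interpret T: bounded_linear T .
  show "bounded_linear (\<lambda>x. a *\<^sub>C T x)"
  proof (rule bounded_linear_intro)
    show "a *\<^sub>C T (x + y) = a *\<^sub>C T x + a *\<^sub>C T y" for x y
      by (simp add: T.add scaleC_add_right)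
    show "a *\<^sub>C T (r *\<^sub>R x) = r *\<^sub>R (a *\<^sub>C T x)" for r x
      by (simp only: T.scaleR) (simp add: scaleR_eq_scaleC scaleC_scaleC mult.commute)
    show "norm (a *\<^sub>C T x) \<le> norm x * (cmod a * onorm T)" for x
      using mult_left_mono[OF onorm[OF \<open>bounded_linear T\<close>, of x] norm_ge_zero[of a]]
      by (simp add: norm_scaleC mult_ac)
  qed
qed

lift_definition rank_one :: "'a::complex_hilbert \<Rightarrow> 'a \<Rightarrow> ('a \<Rightarrow>\<^sub>L 'a)" (infix "\<otimes>\<^sub>H" 70)
  is "\<lambda>x y h. \<langle>h, y\<rangle> *\<^sub>C x"
proof -
  fix x y :: 'a
  show "bounded_linear (\<lambda>h. \<langle>h, y\<rangle> *\<^sub>C x)"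
  proof (rule bounded_linear_intro)
    show "\<langle>h + k, y\<rangle> *\<^sub>C x = \<langle>h, y\<rangle> *\<^sub>C x + \<langle>k, y\<rangle> *\<^sub>C x" for h k
      by (simp add: cinner_add_left scaleC_add_left)
    show "\<langle>r *\<^sub>R h, y\<rangle> *\<^sub>C x = r *\<^sub>R (\<langle>h, y\<rangle> *\<^sub>C x)" for r h
      by (simp add: scaleR_eq_scaleC cinner_scaleC_left scaleC_scaleC)
    show "norm (\<langle>h, y\<rangle> *\<^sub>C x) \<le> norm h * (norm y * norm x)" for h
      using mult_right_mono[OF cinner_Cauchy_Schwarz[of h y] norm_ge_zero[of x]]
      by (simp add: norm_scaleC mult_ac)
  qed
qed

definition op_power :: "('a::complex_hilbert \<Rightarrow>\<^sub>L 'a) \<Rightarrow> nat \<Rightarrow> ('a \<Rightarrow>\<^sub>L 'a)" where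
  "op_power T n = ((\<lambda>S. T o\<^sub>L S) ^^ n) id_blinfun"

text \<open>For \<open>T \<in> bounded_ops\<close> these descriptions denote unique operators: the adjoint always exists (Riesz), the
  inverse exists exactly when \<open>op_invertible T\<close> holds, and the square root exists exactly when
  \<open>T\<close> is positive.\<close>

definition op_adj :: "('a::complex_hilbert \<Rightarrow>\<^sub>L 'a) \<Rightarrow> ('a \<Rightarrow>\<^sub>L 'a)" where
  "op_adj T = (THE S. S \<in> bounded_ops \<and>
     (\<forall>x y. \<langle>T x, y\<rangle> = \<langle>x, S y\<rangle>))"

definition op_invertible :: "('a::complex_hilbert \<Rightarrow>\<^sub>L 'a) \<Rightarrow> bool" where
  "op_invertible T \<longleftrightarrow> (\<exists>S\<in>bounded_ops. S o\<^sub>L T = id_blinfun \<and> T o\<^sub>L S = id_blinfun)"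

definition op_inv :: "('a::complex_hilbert \<Rightarrow>\<^sub>L 'a) \<Rightarrow> ('a \<Rightarrow>\<^sub>L 'a)" where
  "op_inv T = (THE S. S \<in> bounded_ops \<and> S o\<^sub>L T = id_blinfun \<and> T o\<^sub>L S = id_blinfun)"

definition op_positive :: "('a::complex_hilbert \<Rightarrow>\<^sub>L 'a) \<Rightarrow> bool" where
  "op_positive T \<longleftrightarrow> T \<in> bounded_ops \<and>
     (\<forall>x. \<langle>T x, x\<rangle> \<in> \<real> \<and> 0 \<le> Re \<langle>T x, x\<rangle>)"

definition op_sqrt :: "('a::complex_hilbert \<Rightarrow>\<^sub>L 'a) \<Rightarrow> ('a \<Rightarrow>\<^sub>L 'a)" where
  "op_sqrt T = (THE Q. op_positive Q \<and> Q o\<^sub>L Q = T)"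

definition op_spectrum :: "('a::complex_hilbert \<Rightarrow>\<^sub>L 'a) \<Rightarrow> complex set" where
  "op_spectrum T = {l. \<not> op_invertible (T - op_scaleC l id_blinfun)}"

definition op_spectral_radius :: "('a::complex_hilbert \<Rightarrow>\<^sub>L 'a) \<Rightarrow> real" where
  "op_spectral_radius T = (SUP l\<in>op_spectrum T. cmod l)"

definition op_eigenvector :: "('a::complex_hilbert \<Rightarrow>\<^sub>L 'a) \<Rightarrow> 'a \<Rightarrow> bool" where
  "op_eigenvector T v \<longleftrightarrow> v \<noteq> 0 \<and> (\<exists>l. T v = l *\<^sub>C v)"


section \<open>Majorization, Deddens algebras and spectral radius algebras\<close>

definition majorizes :: "('a::complex_hilbert \<Rightarrow>\<^sub>L 'a) \<Rightarrow> ('a \<Rightarrow>\<^sub>L 'a) \<Rightarrow> bool" where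
  "majorizes T S \<longleftrightarrow> (\<exists>M>0. \<forall>x. norm (S x) \<le> M * norm (T x))"

text \<open>Letting \<open>n\<close> start at 0 or at 1 gives the same set, because \<open>S\<close> is bounded.\<close>

definition deddens_algebra :: "('a::complex_hilbert \<Rightarrow>\<^sub>L 'a) \<Rightarrow> ('a \<Rightarrow>\<^sub>L 'a) set" where
  "deddens_algebra T = {S \<in> bounded_ops. \<exists>M>0. \<forall>n x.
     norm ((op_power T n o\<^sub>L S) x) \<le> M * norm ((op_power T n) x)}"

definition sra_d :: "('a::complex_hilbert \<Rightarrow>\<^sub>L 'a) \<Rightarrow> nat \<Rightarrow> real" where
  "sra_d T m = 1 / (1 / real m + op_spectral_radius T)"

text \<open>For \<open>m \<ge> 1\<close> the series converges in the operator norm, the topology of the library type.\<close>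

definition sra_R :: "('a::complex_hilbert \<Rightarrow>\<^sub>L 'a) \<Rightarrow> nat \<Rightarrow> ('a \<Rightarrow>\<^sub>L 'a)" where
  "sra_R T m = op_sqrt (\<Sum>n. sra_d T m ^ (2 * n) *\<^sub>R (op_power (op_adj T) n o\<^sub>L op_power T n))"

definition spectral_radius_algebra :: "('a::complex_hilbert \<Rightarrow>\<^sub>L 'a) \<Rightarrow> ('a \<Rightarrow>\<^sub>L 'a) set" where
  "spectral_radius_algebra T = {S \<in> bounded_ops.
     bdd_above ((\<lambda>m. norm (sra_R T m o\<^sub>L S o\<^sub>L op_inv (sra_R T m))) ` {1..})}"

end

theory Submission
  imports Defs
begin

text \<open>With \<open>u = A\<inverse>x\<close> and \<open>v = A\<^sup>*y\<close>, similarity means \<open>T = u \<otimes> v\<close>, so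
  \<open>T\<^sup>n\<^sup>+\<^sup>1 = \<langle>u, v\<rangle>\<^sup>n T\<close> and the Deddens condition reduces to \<open>n = 1\<close>. Moreover
  \<open>r(T) = |\<langle>u, v\<rangle>|\<close>, and a geometric series gives \<open>R\<^sub>m = I + t\<^sub>m (v \<otimes> v)\<close> with
  \<open>t\<^sub>m \<rightarrow> \<infinity>\<close>. Since \<open>R\<^sub>m\<close> fixes the orthogonal complement of \<open>v\<close> and stretches \<open>v\<close> by
  an unbounded factor, the conjugates \<open>R\<^sub>m S R\<^sub>m\<inverse>\<close> stay bounded exactly when \<open>S\<close> leaves that
  complement invariant, i.e. when \<open>v\<close> is an eigenvector of \<open>S\<^sup>*\<close>.\<close>

section \<open>Inner product identities and the Riesz representation\<close>

text \<open>It supplies the vector space rules for complex scalars, above all the simp rules for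
  zero and the distributive laws over differences.\<close>

interpretation cvs: vector_space "(*\<^sub>C) :: complex \<Rightarrow> 'a \<Rightarrow> 'a::complex_hilbert"
  by standard (simp_all add: scaleC_add_right scaleC_add_left scaleC_scaleC scaleC_one)

lemma cinner_add_right: "\<langle>x, y + z\<rangle> = \<langle>x, y\<rangle> + \<langle>x, z :: 'a::complex_hilbert\<rangle>"
  by (metis cinner_add_left cinner_commute complex_cnj_add)

lemma cinner_scaleC_right: "\<langle>x, a *\<^sub>C y\<rangle> = cnj a * \<langle>x, y :: 'a::complex_hilbert\<rangle>"
  by (metis cinner_scaleC_left cinner_commute complex_cnj_mult)

lemma cinner_zero_left [simp]: "\<langle>0, x :: 'a::complex_hilbert\<rangle> = 0"
  using cinner_scaleC_left[of 0 x x] by simp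

lemma cinner_zero_right [simp]: "\<langle>x, 0 :: 'a::complex_hilbert\<rangle> = 0"
  by (metis cinner_commute cinner_zero_left complex_cnj_zero)

lemma cinner_minus_left: "\<langle>- x, y :: 'a::complex_hilbert\<rangle> = - \<langle>x, y\<rangle>"
  using cinner_add_left[of x "- x" y] by (simp add: eq_neg_iff_add_eq_0 add.commute)

lemma cinner_minus_right: "\<langle>x, - y :: 'a::complex_hilbert\<rangle> = - \<langle>x, y\<rangle>"
  by (metis cinner_commute cinner_minus_left complex_cnj_minus)

lemma cinner_diff_left: "\<langle>x - y, z :: 'a::complex_hilbert\<rangle> = \<langle>x, z\<rangle> - \<langle>y, z\<rangle>"
  using cinner_add_left[of x "- y" z] by (simp add: cinner_minus_left)

lemma cinner_diff_right: "\<langle>x, y - z :: 'a::complex_hilbert\<rangle> = \<langle>x, y\<rangle> - \<langle>x, z\<rangle>"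
  using cinner_add_right[of x y "- z"] by (simp add: cinner_minus_right)

lemma cinner_scaleR_left: "\<langle>r *\<^sub>R x, y :: 'a::complex_hilbert\<rangle> = complex_of_real r * \<langle>x, y\<rangle>"
  by (simp add: scaleR_eq_scaleC cinner_scaleC_left)

lemma cinner_scaleR_right: "\<langle>x, r *\<^sub>R y :: 'a::complex_hilbert\<rangle> = complex_of_real r * \<langle>x, y\<rangle>"
  by (simp add: scaleR_eq_scaleC cinner_scaleC_right)

lemmas cinner_linear_simps =
  cinner_add_left cinner_add_right cinner_diff_left cinner_diff_right
  cinner_minus_left cinner_minus_right cinner_scaleC_left cinner_scaleC_right
  cinner_scaleR_left cinner_scaleR_right

lemma cinner_eqI:
  assumes "\<And>z. \<langle>z, x\<rangle> = \<langle>z, y :: 'a::complex_hilbert\<rangle>"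
  shows "x = y"
proof -
  have "\<langle>x - y, x - y\<rangle> = 0"
    using assms[of "x - y"] by (simp add: cinner_diff_right)
  then show ?thesis by (simp add: cinner_self)
qed

lemma norm_add_sqr:
  "(norm (x + y :: 'a::complex_hilbert))\<^sup>2 = (norm x)\<^sup>2 + 2 * Re \<langle>x, y\<rangle> + (norm y)\<^sup>2"
proof -
  have "complex_of_real ((norm (x + y))\<^sup>2) =
      of_real ((norm x)\<^sup>2) + (\<langle>x, y\<rangle> + cnj \<langle>x, y\<rangle>) + of_real ((norm y)\<^sup>2)"
    unfolding cinner_self[symmetric] cinner_commute[of y x, symmetric]
    by (simp add: cinner_linear_simps)
  also have "\<langle>x, y\<rangle> + cnj \<langle>x, y\<rangle> = of_real (2 * Re \<langle>x, y\<rangle>)"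
    by (rule complex_add_cnj)
  finally show ?thesis
    by (metis of_real_add of_real_eq_iff)
qed

text \<open>The representing vector minimises \<open>(norm x)\<^sup>2 - 2 * Re (f x)\<close>; the parallelogram law makes
  every minimising sequence of this functional a Cauchy sequence.\<close>

theorem riesz_representation:
  fixes f :: "'a::complex_hilbert \<Rightarrow> complex"
  assumes f: "bounded_linear f" and fC: "\<And>a x. f (a *\<^sub>C x) = a * f x"
  obtains w where "\<And>x. f x = \<langle>x, w\<rangle>"
proof -
  interpret f: bounded_linear f by (rule f)
  define J where "J x = (norm x)\<^sup>2 - 2 * Re (f x)" for x
  obtain K where K: "\<And>x. cmod (f x) \<le> norm x * K"
    using f.bounded by blast
  \<comment> \<open>Completing the square: \<open>norm x * K\<close> bounds \<open>Re (f x)\<close>,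
    and \<open>(norm x - K)\<^sup>2\<close> is nonnegative.\<close>
  have lower: "- K\<^sup>2 \<le> J x" for x
  proof -
    have "Re (f x) \<le> norm x * K"
      using K[of x] complex_Re_le_cmod[of "f x"] by linarith
    moreover have "0 \<le> (norm x - K)\<^sup>2" by simp
    ultimately show ?thesis
      unfolding J_def power2_diff by linarith
  qed
  define I where "I = (INF x. J x)"
  have bdd: "bdd_below (range J)"
    using lower by (intro bdd_belowI[of _ "- K\<^sup>2"]) auto
  have I_le: "I \<le> J x" for x
    unfolding I_def using bdd by (rule cINF_lower) simp
  have "\<exists>x. J x < I + 1 / real (Suc n)" for n
    using cINF_less_iff[OF _ bdd, of "I + 1 / real (Suc n)"] unfolding I_def by auto
  then obtain a where a: "\<And>n. J (a n) < I + 1 / real (Suc n)"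
    by metis
  \<comment> \<open>The contributions of \<open>f\<close> cancel because its value at the midpoint
    is the average; what remains is the parallelogram law.\<close>
  have par: "(norm (x - y))\<^sup>2 = 2 * J x + 2 * J y - 4 * J ((1/2) *\<^sub>R (x + y))" for x y
  proof -
    define m where "m = (1/2) *\<^sub>R (x + y)"
    have "J m = (norm (x + y))\<^sup>2 / 4 - Re (f x) - Re (f y)"
      by (simp add: m_def J_def f.scaleR f.add power_divide add_divide_distrib)
    moreover have "J x = (norm x)\<^sup>2 - 2 * Re (f x)" "J y = (norm y)\<^sup>2 - 2 * Re (f y)"
      by (simp_all only: J_def)
    moreover have "(norm (x - y))\<^sup>2 = (norm x)\<^sup>2 - 2 * Re \<langle>x, y\<rangle> + (norm y)\<^sup>2"
      using norm_add_sqr[of x "- y"] by (simp add: cinner_minus_right)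
    ultimately show ?thesis
      unfolding m_def[symmetric] norm_add_sqr[of x y] by (simp add: field_simps)
  qed
  \<comment> \<open>Both \<open>J (a m)\<close> and \<open>J (a n)\<close> exceed \<open>I\<close>
    by less than \<open>1 / real (Suc N)\<close>, while the midpoint value is at least
    \<open>I\<close>; the weights in \<open>par\<close> then give the constant 4.\<close>
  have close: "(norm (a m - a n))\<^sup>2 < 4 / real (Suc N)" if "N \<le> m" "N \<le> n" for m n N
  proof -
    have "1 / real (Suc m) \<le> 1 / real (Suc N)" "1 / real (Suc n) \<le> 1 / real (Suc N)"
      using that by (simp_all add: frac_le)
    then have "(norm (a m - a n))\<^sup>2 < 4 * (1 / real (Suc N))"
      unfolding par using a[of m] a[of n] I_le[of "(1/2) *\<^sub>R (a m + a n)"] by linarith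
    then show ?thesis by simp
  qed
  have "Cauchy a"
  proof (rule metric_CauchyI)
    fix e :: real assume "0 < e"
    obtain N where N: "4 / e\<^sup>2 < real N" using reals_Archimedean2 by blast
    have "4 / real (Suc N) < e\<^sup>2"
    proof -
      have "4 < real N * e\<^sup>2" using N \<open>0 < e\<close> by (simp add: pos_divide_less_eq)
      also have "\<dots> \<le> real (Suc N) * e\<^sup>2" by (intro mult_right_mono) auto
      finally show ?thesis by (simp add: pos_divide_less_eq mult.commute)
    qed
    then have "(norm (a m - a n))\<^sup>2 < e\<^sup>2" if "N \<le> m" "N \<le> n" for m n
      using close[OF that] by linarith
    then have "\<forall>m\<ge>N. \<forall>n\<ge>N. dist (a m) (a n) < e"
      using \<open>0 < e\<close> unfolding dist_norm by (meson less_imp_le power_less_imp_less_base)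
    then show "\<exists>N. \<forall>m\<ge>N. \<forall>n\<ge>N. dist (a m) (a n) < e" ..
  qed
  then obtain w where w: "a \<longlonglongrightarrow> w"
    using Cauchy_convergent_iff convergent_def by blast
  have "(\<lambda>n. J (a n)) \<longlonglongrightarrow> J w"
    unfolding J_def by (intro tendsto_intros f.tendsto w)
  moreover have "(\<lambda>n. I + 1 / real (Suc n)) \<longlonglongrightarrow> I + 0"
    by (intro tendsto_intros LIMSEQ_Suc lim_1_over_n)
  ultimately have "J w \<le> I + 0"
    using a by (intro LIMSEQ_le[of "\<lambda>n. J (a n)"]) (auto intro: less_imp_le)
  then have min: "J w \<le> J x" for x
    using I_le[of x] by linarith
  \<comment> \<open>First variation: along every real line through the minimiser \<open>w\<close>
    the increment of \<open>J\<close> is a nonnegative quadratic in \<open>t\<close> without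
    constant term, so its linear coefficient \<open>2 * b\<close> vanishes.\<close>
  have re: "Re (f h) = Re \<langle>h, w\<rangle>" for h
  proof -
    define b where "b = Re \<langle>w, h\<rangle> - Re (f h)"
    have quad: "0 \<le> t\<^sup>2 * (norm h)\<^sup>2 + 2 * t * b" for t
    proof -
      have "J (w + t *\<^sub>R h) = J w + (t\<^sup>2 * (norm h)\<^sup>2 + 2 * t * b)"
        by (simp add: J_def b_def norm_add_sqr cinner_scaleR_right f.add f.scaleR
            power_mult_distrib algebra_simps)
      then show ?thesis using min[of "w + t *\<^sub>R h"] by linarith
    qed
    \<comment> \<open>Adding 1 keeps the denominator positive when \<open>h = 0\<close>; at
      \<open>t = - b / n\<close> the quadratic is negative unless \<open>b = 0\<close>.\<close>
    define n where "n = (norm h)\<^sup>2 + 1"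
    have "n > 0" unfolding n_def by (simp add: add_nonneg_pos)
    have "0 \<le> (- b / n)\<^sup>2 * (n - 1) + 2 * (- b / n) * b"
      using quad[of "- b / n"] by (simp add: n_def)
    also have "\<dots> = - (b\<^sup>2 * (n + 1)) / n\<^sup>2"
      using \<open>n > 0\<close> by (simp add: field_simps power2_eq_square)
    finally have "b\<^sup>2 * (n + 1) \<le> 0"
      using \<open>n > 0\<close> by (auto simp: divide_le_0_iff)
    then have "b = 0"
      using \<open>n > 0\<close> by (auto simp: mult_le_0_iff)
    then show ?thesis
      using cinner_commute[of h w] by (simp add: b_def)
  qed
  \<comment> \<open>Replacing \<open>h\<close> by \<open>\<i> *\<^sub>C h\<close> turns the identity
    of real parts into that of imaginary parts.\<close>
  have "f h = \<langle>h, w\<rangle>" for h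
    using re[of h] re[of "\<i> *\<^sub>C h"] by (simp add: fC cinner_scaleC_left complex_eq_iff)
  then show ?thesis by (rule that)
qed

section \<open>Adjoints, inverses, powers and square roots\<close>

lemma bounded_ops_scaleC: "T \<in> bounded_ops \<Longrightarrow> T (a *\<^sub>C x) = a *\<^sub>C T x"
  by (simp add: bounded_ops_def)

lemma id_bounded_ops [simp]: "id_blinfun \<in> bounded_ops"
  by (simp add: bounded_ops_def)

lemma bounded_ops_add: "S \<in> bounded_ops \<Longrightarrow> T \<in> bounded_ops \<Longrightarrow> S + T \<in> bounded_ops"
  by (simp add: bounded_ops_def blinfun.add_left scaleC_add_right)

lemma bounded_ops_scaleR: "T \<in> bounded_ops \<Longrightarrow> r *\<^sub>R T \<in> bounded_ops"
  by (simp add: bounded_ops_def blinfun.scaleR_left scaleR_eq_scaleC scaleC_scaleC mult.commute)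

lemma bounded_ops_op_scaleC: "T \<in> bounded_ops \<Longrightarrow> op_scaleC a T \<in> bounded_ops"
  by (simp add: bounded_ops_def op_scaleC.rep_eq scaleC_scaleC mult.commute)

lemma bounded_ops_rank_one [simp]: "x \<otimes>\<^sub>H y \<in> bounded_ops"
  by (simp add: bounded_ops_def rank_one.rep_eq cinner_scaleC_left scaleC_scaleC)

text \<open>The inner products of \<open>S y\<close> with all vectors determine it, so the
  description defining \<open>op_adj\<close> has at most one solution.\<close>

lemma op_adj_eqI:
  fixes S T :: "'a::complex_hilbert \<Rightarrow>\<^sub>L 'a"
  assumes "S \<in> bounded_ops" and "\<And>x y. \<langle>T x, y\<rangle> = \<langle>x, S y\<rangle>"
  shows "op_adj T = S"
  unfolding op_adj_def
proof (rule the_equality)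
  fix S' assume "S' \<in> bounded_ops \<and> (\<forall>x y. \<langle>T x, y\<rangle> = \<langle>x, S' y\<rangle>)"
  then have "\<langle>z, S' y\<rangle> = \<langle>z, S y\<rangle>" for y z
    using assms(2)[of z y] by simp
  then show "S' = S"
    by (blast intro: blinfun_eqI cinner_eqI[where 'a = 'a])
qed (use assms in auto)

text \<open>The Riesz theorem, applied to \<open>\<lambda>x. \<langle>T x, y\<rangle>\<close> for
  each \<open>y\<close>, gives a function \<open>S\<close>; its linearity and its bound follow from
  the adjoint relation.\<close>

lemma op_adj_exists:
  assumes T: "T \<in> bounded_ops"
  shows "\<exists>S\<in>bounded_ops. \<forall>x y. \<langle>blinfun_apply T x, y\<rangle> = \<langle>x, blinfun_apply S y\<rangle>"
proof -
  have "\<exists>w. \<forall>x. \<langle>T x, y\<rangle> = \<langle>x, w\<rangle>" for y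
  proof -
    have "bounded_linear (\<lambda>x. \<langle>T x, y\<rangle>)"
    proof (rule bounded_linear_intro)
      show "norm \<langle>T x, y\<rangle> \<le> norm x * (norm T * norm y)" for x
      proof -
        have "norm \<langle>T x, y\<rangle> \<le> norm (T x) * norm y" by (rule cinner_Cauchy_Schwarz)
        also have "\<dots> \<le> (norm T * norm x) * norm y"
          by (intro mult_right_mono norm_blinfun) simp
        finally show ?thesis by (simp add: mult_ac)
      qed
    qed (simp_all add: blinfun.add_right blinfun.scaleR_right cinner_linear_simps scaleR_conv_of_real)
    moreover have "\<langle>T (a *\<^sub>C x), y\<rangle> = a * \<langle>T x, y\<rangle>" for a x
      by (simp add: bounded_ops_scaleC[OF T] cinner_scaleC_left)
    ultimately show ?thesis
      using riesz_representation[of "\<lambda>x. \<langle>T x, y\<rangle>"] by metis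
  qed
  then obtain S where S: "\<And>x y. \<langle>T x, y\<rangle> = \<langle>x, S y\<rangle>" by metis
  have lin: "S (a *\<^sub>C y) = a *\<^sub>C S y" for a y
    by (rule cinner_eqI) (simp add: S[symmetric] cinner_scaleC_right)
  have "bounded_linear S"
  proof (rule bounded_linear_intro)
    show "S (y + z) = S y + S z" for y z
      by (rule cinner_eqI) (simp add: S[symmetric] cinner_add_right)
    show "S (r *\<^sub>R y) = r *\<^sub>R S y" for r y
      by (simp add: scaleR_eq_scaleC lin)
    show "norm (S y) \<le> norm y * norm T" for y
    proof (cases "S y = 0")
      case False
      \<comment> \<open>Testing the adjoint relation on \<open>S y\<close> itself produces the
        squared norm; one factor \<open>norm (S y)\<close> is cancelled afterwards.\<close>
      have "(norm (S y))\<^sup>2 = cmod \<langle>T (S y), y\<rangle>"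
        by (simp add: S cinner_self norm_power)
      also have "\<dots> \<le> norm (T (S y)) * norm y" by (rule cinner_Cauchy_Schwarz)
      also have "\<dots> \<le> (norm T * norm (S y)) * norm y"
        by (intro mult_right_mono norm_blinfun) simp
      finally have "norm (S y) * norm (S y) \<le> norm (S y) * (norm y * norm T)"
        by (simp add: power2_eq_square mult_ac)
      then show ?thesis using False by simp
    qed simp
  qed
  then have "blinfun_apply (Blinfun S) = S" by (rule bounded_linear_Blinfun_apply)
  with S lin show ?thesis
    by (intro bexI[of _ "Blinfun S"]) (auto simp: bounded_ops_def)
qed

lemma cinner_op_adj:
  assumes "T \<in> bounded_ops"
  shows "\<langle>T x, y\<rangle> = \<langle>x, op_adj T y\<rangle>"
proof -
  obtain S where "S \<in> bounded_ops" "\<And>x y. \<langle>T x, y\<rangle> = \<langle>x, S y\<rangle>"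
    using op_adj_exists[OF assms] by blast
  moreover from this have "op_adj T = S" by (rule op_adj_eqI)
  ultimately show ?thesis by simp
qed

lemma op_adj_rank_one: "op_adj (u \<otimes>\<^sub>H v) = v \<otimes>\<^sub>H u"
proof (rule op_adj_eqI)
  show "\<langle>(u \<otimes>\<^sub>H v) x, y\<rangle> = \<langle>x, (v \<otimes>\<^sub>H u) y\<rangle>" for x y
    using cinner_commute[of u y]
    by (simp add: rank_one.rep_eq cinner_scaleC_left cinner_scaleC_right)
qed simp

lemma op_inv_eqI:
  assumes "S \<in> bounded_ops" "S o\<^sub>L T = id_blinfun" "T o\<^sub>L S = id_blinfun"
  shows "op_inv T = S"
  unfolding op_inv_def
proof (rule the_equality)
  fix S' assume "S' \<in> bounded_ops \<and> S' o\<^sub>L T = id_blinfun \<and> T o\<^sub>L S' = id_blinfun"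
  then show "S' = S"
    using assms(3) by (intro blinfun_eqI) (metis blinfun_apply_blinfun_compose blinfun_apply_id_blinfun id_apply)
qed (use assms in auto)

lemma op_invertible_op_inv:
  assumes "op_invertible T"
  shows "op_inv T \<in> bounded_ops" "op_inv T o\<^sub>L T = id_blinfun" "T o\<^sub>L op_inv T = id_blinfun"
  using assms op_inv_eqI unfolding op_invertible_def by blast+

lemma op_inv_apply [simp]:
  assumes "op_invertible T"
  shows "op_inv T (T x) = x" "T (op_inv T x) = x"
  using op_invertible_op_inv[OF assms]
  by (metis blinfun_apply_blinfun_compose blinfun_apply_id_blinfun id_apply)+

lemma op_power_0 [simp]: "op_power T 0 = id_blinfun"
  by (simp add: op_power_def)

lemma op_power_Suc_apply: "op_power T (Suc n) x = T (op_power T n x)"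
  by (simp add: op_power_def)

text \<open>The operator maps \<open>u\<close> to \<open>\<langle>u, v\<rangle>\<close> times
  \<open>u\<close>, so each factor after the first contributes this scalar. Exponent 0 gives the
  identity and does not fit the pattern.\<close>

lemma op_power_rank_one_apply:
  "op_power (u \<otimes>\<^sub>H v) (Suc n) h = (\<langle>u, v\<rangle> ^ n * \<langle>h, v\<rangle>) *\<^sub>C u"
  by (induction n)
    (simp_all add: op_power_Suc_apply rank_one.rep_eq cinner_scaleC_left mult_ac)

text \<open>If \<open>Q\<close> is another positive root, then \<open>(Q + B) (Q - B) = 0\<close> because \<open>Q\<close> commutes with
  \<open>B\<close>, and \<open>Q + B\<close> is injective because \<open>B \<ge> I\<close>. This avoids the general uniqueness theorem.\<close>

lemma op_sqrt_eqI:
  fixes B T :: "'a::complex_hilbert \<Rightarrow>\<^sub>L 'a"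
  assumes B: "B \<in> bounded_ops" and sq: "B o\<^sub>L B = T"
    and coercive: "\<And>x. \<langle>B x, x\<rangle> \<in> \<real> \<and> (norm x)\<^sup>2 \<le> Re \<langle>B x, x\<rangle>"
    and comm: "\<And>Q. Q o\<^sub>L T = T o\<^sub>L Q \<Longrightarrow> Q \<in> bounded_ops \<Longrightarrow> Q o\<^sub>L B = B o\<^sub>L Q"
  shows "op_sqrt T = B"
  unfolding op_sqrt_def
proof (rule the_equality)
  have "0 \<le> Re \<langle>B x, x\<rangle>" for x
    using coercive[of x] zero_le_power2[of "norm x"] by linarith
  then show "op_positive B \<and> B o\<^sub>L B = T"
    using B sq coercive by (simp add: op_positive_def)
next
  fix Q assume Q: "op_positive Q \<and> Q o\<^sub>L Q = T"
  have "Q o\<^sub>L (Q o\<^sub>L Q) = (Q o\<^sub>L Q) o\<^sub>L Q"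
    by (rule blinfun_eqI) simp
  then have "Q o\<^sub>L T = T o\<^sub>L Q"
    using Q by simp
  then have QB: "Q o\<^sub>L B = B o\<^sub>L Q"
    using Q comm by (simp add: op_positive_def)
  show "Q = B"
  proof (rule blinfun_eqI)
    fix x
    define w where "w = Q x - B x"
    have "Q (Q x) = B (B x)" "Q (B x) = B (Q x)"
      using Q sq QB by (metis blinfun_apply_blinfun_compose)+
    then have "Q w + B w = 0"
      by (simp add: w_def blinfun.diff_right)
    \<comment> \<open>Pairing with \<open>w\<close> adds a nonnegative term to one that is at least
      \<open>(norm w)\<^sup>2\<close>, which forces \<open>w = 0\<close>.\<close>
    then have "\<langle>Q w, w\<rangle> + \<langle>B w, w\<rangle> = 0"
      by (metis cinner_add_left cinner_zero_left)
    then have "Re \<langle>Q w, w\<rangle> + Re \<langle>B w, w\<rangle> = 0"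
      by (metis plus_complex.sel(1) zero_complex.sel(1))
    moreover have "0 \<le> Re \<langle>Q w, w\<rangle>"
      using Q by (simp add: op_positive_def)
    ultimately have "(norm w)\<^sup>2 \<le> 0"
      using coercive[of w] by linarith
    then show "Q x = B x" by (simp add: w_def)
  qed
qed

section \<open>Spectral radius and the operators \<open>sra_R\<close> in the rank-one case\<close>

text \<open>The vector \<open>u\<close> is an eigenvector for \<open>\<langle>u, v\<rangle>\<close>,
  and every scalar other than 0 and \<open>\<langle>u, v\<rangle>\<close> has an explicit resolvent.
  Whether 0 lies in the spectrum depends on the dimension, but it does not affect the supremum of
  the moduli.\<close>

lemma op_spectral_radius_rank_one:
  assumes "u \<noteq> (0 :: 'a::complex_hilbert)"
  shows "op_spectral_radius (u \<otimes>\<^sub>H v) = cmod \<langle>u, v\<rangle>"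
proof -
  let ?T = "u \<otimes>\<^sub>H v" and ?c = "\<langle>u, v\<rangle>"
  have "?c \<in> op_spectrum ?T"
  proof -
    have "(?T - op_scaleC ?c id_blinfun) u = 0"
      by (simp add: blinfun.diff_left rank_one.rep_eq op_scaleC.rep_eq)
    then have "\<not> op_invertible (?T - op_scaleC ?c id_blinfun)"
      using op_inv_apply(1)[of _ u] assms by (metis blinfun.zero_right)
    then show ?thesis by (simp add: op_spectrum_def)
  qed
  moreover have "op_spectrum ?T \<subseteq> {0, ?c}"
  proof
    fix l assume l: "l \<in> op_spectrum ?T"
    show "l \<in> {0, ?c}"
    proof (rule ccontr)
      assume "l \<notin> {0, ?c}"
      then have nz: "l \<noteq> 0" "l - ?c \<noteq> 0" by auto
      \<comment> \<open>The Sherman-Morrison formula for the resolvent, which rests on the square of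
        \<open>?T\<close> being \<open>?c\<close> times \<open>?T\<close>.\<close>
      define N where "N = op_scaleC (- 1 / l) (id_blinfun + op_scaleC (1 / (l - ?c)) ?T)"
      have "N \<in> bounded_ops"
        unfolding N_def by (intro bounded_ops_op_scaleC bounded_ops_add) simp_all
      moreover have "N o\<^sub>L (?T - op_scaleC l id_blinfun) = id_blinfun"
        "(?T - op_scaleC l id_blinfun) o\<^sub>L N = id_blinfun"
      proof -
        have N: "N h = (- 1 / l) *\<^sub>C h - (\<langle>h, v\<rangle> / (l * (l - ?c))) *\<^sub>C u" for h
          by (simp add: N_def op_scaleC.rep_eq blinfun.add_left rank_one.rep_eq scaleC_add_right
              scaleC_scaleC)
        show "N o\<^sub>L (?T - op_scaleC l id_blinfun) = id_blinfun"
        proof (rule blinfun_eqI)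
          fix h
          have "(N o\<^sub>L (?T - op_scaleC l id_blinfun)) h =
              (1 / l * l) *\<^sub>C h + (- \<langle>h, v\<rangle> / l - (\<langle>h, v\<rangle> * ?c - l * \<langle>h, v\<rangle>) / (l * (l - ?c))) *\<^sub>C u"
            unfolding cvs.scale_left_diff_distrib
            by (simp add: N blinfun.diff_left op_scaleC.rep_eq rank_one.rep_eq cinner_linear_simps
                cvs.scale_right_diff_distrib)
          also have "- \<langle>h, v\<rangle> / l - (\<langle>h, v\<rangle> * ?c - l * \<langle>h, v\<rangle>) / (l * (l - ?c)) = 0"
            using nz by (simp add: field_simps)
          finally show "(N o\<^sub>L (?T - op_scaleC l id_blinfun)) h = id_blinfun h"
            using nz by simp
        qed
        show "(?T - op_scaleC l id_blinfun) o\<^sub>L N = id_blinfun"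
        proof (rule blinfun_eqI)
          fix h
          have "((?T - op_scaleC l id_blinfun) o\<^sub>L N) h = (l * (1 / l)) *\<^sub>C h +
              (- \<langle>h, v\<rangle> / l - \<langle>h, v\<rangle> / (l * (l - ?c)) * ?c + l * (\<langle>h, v\<rangle> / (l * (l - ?c)))) *\<^sub>C u"
            unfolding cvs.scale_left_diff_distrib scaleC_add_left
            by (simp add: N blinfun.diff_left op_scaleC.rep_eq rank_one.rep_eq cinner_linear_simps
                cvs.scale_right_diff_distrib cvs.scale_left_diff_distrib)
          also have "- \<langle>h, v\<rangle> / l - \<langle>h, v\<rangle> / (l * (l - ?c)) * ?c + l * (\<langle>h, v\<rangle> / (l * (l - ?c))) = 0"
            using nz by (simp add: field_simps)
          finally show "((?T - op_scaleC l id_blinfun) o\<^sub>L N) h = id_blinfun h"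
            using nz by simp
        qed
      qed
      ultimately show False
        using l by (auto simp: op_spectrum_def op_invertible_def)
    qed
  qed
  ultimately have "op_spectrum ?T = {?c} \<or> op_spectrum ?T = {0, ?c}"
    by auto
  then show ?thesis
    unfolding op_spectral_radius_def by (auto simp: cSup_insert sup_max)
qed

text \<open>With \<open>P = v \<otimes>\<^sub>H v\<close>, the square of \<open>P\<close> is
  \<open>(norm v)\<^sup>2 *\<^sub>R P\<close>, which explains the form of \<open>k\<close>. For
  \<open>k \<noteq> 0\<close>, commuting with the operator under the root means commuting with
  \<open>P\<close>, hence with the claimed root; \<open>t = 0\<close> is the case of the
  identity.\<close>

lemma op_sqrt_id_plus_rank_one:
  fixes v :: "'a::complex_hilbert"
  assumes "0 \<le> t" and k: "k = t * (2 + t * (norm v)\<^sup>2)"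
  shows "op_sqrt (id_blinfun + k *\<^sub>R (v \<otimes>\<^sub>H v)) = id_blinfun + t *\<^sub>R (v \<otimes>\<^sub>H v)"
proof (cases "t = 0")
  case False
  let ?P = "v \<otimes>\<^sub>H v" and ?B = "id_blinfun + t *\<^sub>R (v \<otimes>\<^sub>H v)"
  have "0 < t * (2 + t * (norm v)\<^sup>2)"
    using False \<open>0 \<le> t\<close> by (intro mult_pos_pos add_pos_nonneg) auto
  then have "k \<noteq> 0"
    using k by (metis less_irrefl)
  have P: "?P (?P h) = (norm v)\<^sup>2 *\<^sub>R ?P h" for h
    by (simp add: rank_one.rep_eq cinner_scaleC_left cinner_self scaleR_eq_scaleC scaleC_scaleC mult_ac)
  show ?thesis
  proof (rule op_sqrt_eqI)
    show "?B o\<^sub>L ?B = id_blinfun + k *\<^sub>R ?P"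
      by (rule blinfun_eqI)
        (simp add: blinfun.add_left blinfun.add_right blinfun.scaleR_left blinfun.scaleR_right P k
          algebra_simps flip: scaleR_left_distrib mult_2_right)
    fix h :: 'a
    have "\<langle>?B h, h\<rangle> = of_real ((norm h)\<^sup>2 + t * (cmod \<langle>h, v\<rangle>)\<^sup>2)"
      using cinner_commute[of v h]
      by (simp add: blinfun.bilinear_simps rank_one.rep_eq cinner_linear_simps cinner_self cmod_mult_cnj)
    then show "\<langle>?B h, h\<rangle> \<in> \<real> \<and> (norm h)\<^sup>2 \<le> Re \<langle>?B h, h\<rangle>"
      using \<open>0 \<le> t\<close> by simp
  next
    fix Q assume Q: "Q o\<^sub>L (id_blinfun + k *\<^sub>R ?P) = (id_blinfun + k *\<^sub>R ?P) o\<^sub>L Q"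
    have "Q (?P h) = ?P (Q h)" for h
    proof -
      have "Q ((id_blinfun + k *\<^sub>R ?P) h) = (id_blinfun + k *\<^sub>R ?P) (Q h)"
        using Q by (metis blinfun_apply_blinfun_compose)
      then show ?thesis
        using \<open>k \<noteq> 0\<close> by (simp add: blinfun.bilinear_simps)
    qed
    then show "Q o\<^sub>L ?B = ?B o\<^sub>L Q"
      by (intro blinfun_eqI) (simp add: blinfun.bilinear_simps)
  qed (intro bounded_ops_add bounded_ops_scaleR id_bounded_ops bounded_ops_rank_one)
next
  case True
  have "op_sqrt id_blinfun = (id_blinfun :: 'a \<Rightarrow>\<^sub>L 'a)"
    by (rule op_sqrt_eqI) (auto intro!: blinfun_eqI simp: cinner_self)
  then show ?thesis
    using True k by simp
qed

text \<open>From \<open>n = 1\<close> on, the terms are multiples of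
  \<open>v \<otimes>\<^sub>H v\<close> that form a geometric series with ratio
  \<open>(d * cmod \<langle>u, v\<rangle>)\<^sup>2\<close>; the term for \<open>n = 0\<close> is the
  identity and is split off.\<close>

lemma rank_one_geometric_sums:
  fixes u v :: "'a::complex_hilbert"
  assumes "0 \<le> d" "d * cmod \<langle>u, v\<rangle> < 1"
  shows "(\<lambda>n. d ^ (2 * n) *\<^sub>R (op_power (v \<otimes>\<^sub>H u) n o\<^sub>L op_power (u \<otimes>\<^sub>H v) n)) sums
    (id_blinfun + (d\<^sup>2 * (norm u)\<^sup>2 / (1 - (d * cmod \<langle>u, v\<rangle>)\<^sup>2)) *\<^sub>R (v \<otimes>\<^sub>H v))"
    (is "?f sums (_ + ?k *\<^sub>R ?P)")
proof -
  let ?r = "cmod \<langle>u, v\<rangle>"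
  have Suc: "?f (Suc n) = (((d * ?r)\<^sup>2) ^ n * (d\<^sup>2 * (norm u)\<^sup>2)) *\<^sub>R ?P" for n
  proof (rule blinfun_eqI)
    fix h
    have uv: "\<langle>v, u\<rangle> ^ n * \<langle>u, v\<rangle> ^ n = complex_of_real (?r\<^sup>2 ^ n)"
      by (metis cinner_commute cmod_mult_cnj of_real_power power_mult_distrib mult.commute)
    have "?f (Suc n) h =
        (complex_of_real (d ^ (2 * Suc n)) * (\<langle>v, u\<rangle> ^ n * \<langle>u, v\<rangle> ^ n)
          * complex_of_real ((norm u)\<^sup>2) * \<langle>h, v\<rangle>) *\<^sub>C v"
      by (simp only: blinfun.scaleR_left blinfun_apply_blinfun_compose op_power_rank_one_apply
          cinner_scaleC_left cinner_self scaleR_eq_scaleC scaleC_scaleC of_real_power mult_ac)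
    also have "\<dots> = ((((d * ?r)\<^sup>2) ^ n * (d\<^sup>2 * (norm u)\<^sup>2)) *\<^sub>R ?P) h"
      unfolding uv power_mult[of d 2 "Suc n"] power_Suc
      by (simp add: blinfun.scaleR_left rank_one.rep_eq scaleR_eq_scaleC power_mult_distrib mult_ac)
    finally show "?f (Suc n) h = ((((d * ?r)\<^sup>2) ^ n * (d\<^sup>2 * (norm u)\<^sup>2)) *\<^sub>R ?P) h" .
  qed
  have "(\<lambda>n. ((d * ?r)\<^sup>2) ^ n) sums (1 / (1 - (d * ?r)\<^sup>2))"
    using assms by (intro geometric_sums) (simp add: power_less_one_iff abs_square_less_1)
  then have "(\<lambda>n. ((d * ?r)\<^sup>2) ^ n * (d\<^sup>2 * (norm u)\<^sup>2)) sums ?k"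
    using sums_mult2 by fastforce
  then have "(\<lambda>n. ?f (Suc n)) sums (?k *\<^sub>R ?P)"
    unfolding Suc by (rule bounded_linear.sums[OF bounded_linear_scaleR_left])
  then have "?f sums (?k *\<^sub>R ?P + ?f 0)"
    by (rule sums_Suc)
  moreover have "?f 0 = id_blinfun"
    by (rule blinfun_eqI) simp
  ultimately show ?thesis
    by (simp only: add.commute)
qed

text \<open>The last inequality makes the divergence quantitative: the factor
  \<open>1 + t * (norm v)\<^sup>2\<close>, by which the operator stretches \<open>v\<close>, grows
  at least like the square root of \<open>m\<close>.\<close>

lemma sra_R_rank_one:
  fixes u v :: "'a::complex_hilbert"
  assumes "u \<noteq> 0" "v \<noteq> 0" "1 \<le> m"
  obtains t where "0 \<le> t" "sra_R (u \<otimes>\<^sub>H v) m = id_blinfun + t *\<^sub>R (v \<otimes>\<^sub>H v)"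
    "real m * (norm u)\<^sup>2 * (norm v)\<^sup>2 \<le> (1 + 2 * cmod \<langle>u, v\<rangle>) * (1 + t * (norm v)\<^sup>2)\<^sup>2"
proof -
  let ?T = "u \<otimes>\<^sub>H v" and ?r = "cmod \<langle>u, v\<rangle>"
  define e where "e = 1 / real m"
  have e: "0 < e" "e \<le> 1" using \<open>1 \<le> m\<close> by (auto simp: e_def)
  define d where "d = sra_d ?T m"
  have d: "d = 1 / (e + ?r)"
    by (simp add: d_def sra_d_def e_def op_spectral_radius_rank_one[OF \<open>u \<noteq> 0\<close>])
  have er: "0 < e + ?r" using e by (simp add: add_pos_nonneg)
  \<comment> \<open>The coefficient of the series with \<open>d\<close> eliminated, using that
    \<open>(e + ?r)\<^sup>2 - ?r\<^sup>2\<close> equals \<open>e * (e + 2 * ?r)\<close>.\<close>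
  define k where "k = (norm u)\<^sup>2 / (e * (e + 2 * ?r))"
  have "0 < e * (e + 2 * ?r)" using e by (simp add: add_pos_nonneg)
  have dr: "d * ?r < 1" using e er by (simp add: d)
  have "d\<^sup>2 * (e * (e + 2 * ?r)) = (d * (e + ?r))\<^sup>2 - (d * ?r)\<^sup>2"
    by (simp add: power2_eq_square algebra_simps)
  then have "1 - (d * ?r)\<^sup>2 = d\<^sup>2 * (e * (e + 2 * ?r))"
    using er by (simp add: d)
  moreover have "d \<noteq> 0" using er by (simp add: d)
  ultimately have k: "d\<^sup>2 * (norm u)\<^sup>2 / (1 - (d * ?r)\<^sup>2) = k"
    by (simp add: k_def)
  have "0 \<le> k" using e by (simp add: k_def)
  \<comment> \<open>The nonnegative root of the quadratic equation
    \<open>k = t * (2 + t * (norm v)\<^sup>2)\<close>.\<close>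
  define t where "t = (sqrt (1 + k * (norm v)\<^sup>2) - 1) / (norm v)\<^sup>2"
  have t: "1 + t * (norm v)\<^sup>2 = sqrt (1 + k * (norm v)\<^sup>2)"
    using \<open>v \<noteq> 0\<close> by (simp add: t_def)
  then have t2: "(1 + t * (norm v)\<^sup>2)\<^sup>2 = 1 + k * (norm v)\<^sup>2"
    using \<open>0 \<le> k\<close> by simp
  have "0 \<le> t" using \<open>0 \<le> k\<close> by (simp add: t_def)
  have "k * (norm v)\<^sup>2 = (t * (2 + t * (norm v)\<^sup>2)) * (norm v)\<^sup>2"
    using t2 by (simp add: power2_eq_square algebra_simps)
  then have "k = t * (2 + t * (norm v)\<^sup>2)" using \<open>v \<noteq> 0\<close> by simp
  have "sra_R ?T m = op_sqrt (id_blinfun + k *\<^sub>R (v \<otimes>\<^sub>H v))"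
    using rank_one_geometric_sums[of d u v] er dr unfolding k
    by (simp add: sra_R_def op_adj_rank_one flip: d_def) (simp add: sums_iff d)
  also have "\<dots> = id_blinfun + t *\<^sub>R (v \<otimes>\<^sub>H v)"
    by (rule op_sqrt_id_plus_rank_one) fact+
  finally have R: "sra_R ?T m = id_blinfun + t *\<^sub>R (v \<otimes>\<^sub>H v)" .
  \<comment> \<open>Solving for \<open>(norm u)\<^sup>2\<close> and multiplying by \<open>m\<close>
    removes the small factor \<open>e\<close>; the other one is at most \<open>1 + 2 * ?r\<close>
    because \<open>e \<le> 1\<close>.\<close>
  have "(norm u)\<^sup>2 = (e * (e + 2 * ?r)) * k"
    using \<open>0 < e * (e + 2 * ?r)\<close> unfolding k_def
    by (metis less_irrefl nonzero_mult_div_cancel_left times_divide_eq_right)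
  then have "real m * (norm u)\<^sup>2 = (real m * e) * ((e + 2 * ?r) * k)"
    by (simp only: mult.assoc)
  also have "real m * e = 1"
    using \<open>1 \<le> m\<close> by (simp add: e_def)
  finally have "real m * (norm u)\<^sup>2 = (e + 2 * ?r) * k"
    by simp
  also have "\<dots> \<le> (1 + 2 * ?r) * k"
    using e \<open>0 \<le> k\<close> by (intro mult_right_mono) auto
  finally have "real m * (norm u)\<^sup>2 * (norm v)\<^sup>2 \<le> (1 + 2 * ?r) * (k * (norm v)\<^sup>2)"
    using mult_right_mono[of _ _ "(norm v)\<^sup>2"] by (fastforce simp: mult.assoc)
  also have "\<dots> \<le> (1 + 2 * ?r) * (1 + t * (norm v)\<^sup>2)\<^sup>2"
    unfolding t2 by (intro mult_left_mono) auto
  finally show ?thesis using that \<open>0 \<le> t\<close> R by blast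
qed

text \<open>The inverse is again a rank-one perturbation of the identity, with coefficient
  \<open>- s\<close>; the identity \<open>t = s + t * (s * (norm v)\<^sup>2)\<close> makes the
  rank-one terms cancel in both products.\<close>

lemma op_invertible_id_plus_rank_one:
  fixes v :: "'a::complex_hilbert"
  assumes "0 \<le> t"
  shows "op_invertible (id_blinfun + t *\<^sub>R (v \<otimes>\<^sub>H v))"
proof -
  let ?P = "v \<otimes>\<^sub>H v"
  define s where "s = t / (1 + t * (norm v)\<^sup>2)"
  have P: "?P (?P h) = (norm v)\<^sup>2 *\<^sub>R ?P h" for h
    by (simp add: rank_one.rep_eq cinner_scaleC_left cinner_self scaleR_eq_scaleC scaleC_scaleC mult_ac)
  have "1 + t * (norm v)\<^sup>2 > 0" using assms by (simp add: add_pos_nonneg)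
  then have "s * (1 + t * (norm v)\<^sup>2) = t" by (simp add: s_def)
  then have t: "t = s + t * (s * (norm v)\<^sup>2)"
    by (simp add: algebra_simps)
  have eq: "t *\<^sub>R ?P h = s *\<^sub>R ?P h + (t * (s * (norm v)\<^sup>2)) *\<^sub>R ?P h" for h
    using arg_cong[OF t, of "\<lambda>r. r *\<^sub>R ?P h"] by (simp only: scaleR_left_distrib)
  show ?thesis
    unfolding op_invertible_def
  proof (intro bexI conjI)
    show "(id_blinfun + (- s) *\<^sub>R ?P) o\<^sub>L (id_blinfun + t *\<^sub>R ?P) = id_blinfun"
    proof (rule blinfun_eqI)
      fix h
      have "((id_blinfun + (- s) *\<^sub>R ?P) o\<^sub>L (id_blinfun + t *\<^sub>R ?P)) h =
          h + (t *\<^sub>R ?P h - (s *\<^sub>R ?P h + (t * (s * (norm v)\<^sup>2)) *\<^sub>R ?P h))"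
        by (simp add: blinfun.add_left blinfun.add_right blinfun.diff_left blinfun.diff_right
            blinfun.scaleR_left blinfun.scaleR_right blinfun.minus_left blinfun.minus_right P
            algebra_simps)
      then show "((id_blinfun + (- s) *\<^sub>R ?P) o\<^sub>L (id_blinfun + t *\<^sub>R ?P)) h = id_blinfun h"
        unfolding eq[of h, symmetric] by simp
    qed
    show "(id_blinfun + t *\<^sub>R ?P) o\<^sub>L (id_blinfun + (- s) *\<^sub>R ?P) = id_blinfun"
    proof (rule blinfun_eqI)
      fix h
      have "((id_blinfun + t *\<^sub>R ?P) o\<^sub>L (id_blinfun + (- s) *\<^sub>R ?P)) h =
          h + (t *\<^sub>R ?P h - (s *\<^sub>R ?P h + (t * (s * (norm v)\<^sup>2)) *\<^sub>R ?P h))"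
        by (simp add: blinfun.add_left blinfun.add_right blinfun.diff_left blinfun.diff_right
            blinfun.scaleR_left blinfun.scaleR_right blinfun.minus_left blinfun.minus_right P
            algebra_simps)
      then show "((id_blinfun + t *\<^sub>R ?P) o\<^sub>L (id_blinfun + (- s) *\<^sub>R ?P)) h = id_blinfun h"
        unfolding eq[of h, symmetric] by simp
    qed
  qed (intro bounded_ops_add bounded_ops_scaleR id_bounded_ops bounded_ops_rank_one)
qed

section \<open>Deddens algebra and majorization\<close>

text \<open>The majorized operator is \<open>?T\<close> composed with \<open>S\<close>, so
  majorization is the Deddens inequality for \<open>n = 1\<close>. For larger \<open>n\<close> both
  sides only gain the same power of \<open>cmod \<langle>u, v\<rangle>\<close>.\<close>

lemma deddens_algebra_rank_one_iff:
  assumes S: "S \<in> bounded_ops"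
  shows "S \<in> deddens_algebra (u \<otimes>\<^sub>H v) \<longleftrightarrow> majorizes (u \<otimes>\<^sub>H v) (u \<otimes>\<^sub>H op_adj S v)"
proof -
  let ?T = "u \<otimes>\<^sub>H v"
  have adj: "(u \<otimes>\<^sub>H op_adj S v) h = ?T (S h)" for h
    by (simp add: rank_one.rep_eq cinner_op_adj[OF S])
  have pow: "norm (op_power ?T (Suc n) h) = cmod \<langle>u, v\<rangle> ^ n * norm (?T h)" for n h
    by (simp add: op_power_rank_one_apply rank_one.rep_eq norm_scaleC norm_mult norm_power)
  show ?thesis
  proof
    assume "S \<in> deddens_algebra ?T"
    then obtain M where M: "M > 0"
      "\<And>n h. norm ((op_power ?T n o\<^sub>L S) h) \<le> M * norm (op_power ?T n h)"
      unfolding deddens_algebra_def by blast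
    show "majorizes ?T (u \<otimes>\<^sub>H op_adj S v)"
      unfolding majorizes_def adj
      using M(1) M(2)[of "Suc 0"] by (auto simp: pow simp del: op_power_0)
  next
    assume "majorizes ?T (u \<otimes>\<^sub>H op_adj S v)"
    then obtain M where M: "M > 0" "\<And>h. norm (?T (S h)) \<le> M * norm (?T h)"
      unfolding majorizes_def adj by blast
    \<comment> \<open>The summand \<open>norm S\<close> serves \<open>n = 0\<close>, where the
      powers are the identity; \<open>M\<close> serves all other exponents.\<close>
    have "norm ((op_power ?T n o\<^sub>L S) h) \<le> (M + norm S) * norm (op_power ?T n h)" for n h
    proof (cases n)
      case 0
      have "norm (S h) \<le> norm S * norm h" by (rule norm_blinfun)
      also have "\<dots> \<le> (M + norm S) * norm h"
        using M(1) by (intro mult_right_mono) auto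
      finally show ?thesis by (simp add: 0)
    next
      case (Suc k)
      have "norm (?T (S h)) \<le> (M + norm S) * norm (?T h)"
        using M(2)[of h] by (simp add: distrib_right add_increasing2)
      then have "cmod \<langle>u, v\<rangle> ^ k * norm (?T (S h)) \<le>
          cmod \<langle>u, v\<rangle> ^ k * ((M + norm S) * norm (?T h))"
        by (rule mult_left_mono) simp
      then show ?thesis
        by (simp add: Suc pow mult_ac)
    qed
    then show "S \<in> deddens_algebra ?T"
      unfolding deddens_algebra_def using S M(1)
      by (auto intro!: exI[of _ "M + norm S"] add_pos_nonneg)
  qed
qed

text \<open>The common factor \<open>norm u\<close> cancels. For \<open>u = 0\<close> both operators
  vanish and majorization says nothing about \<open>v\<close> and \<open>w\<close>.\<close>

lemma majorizes_rank_one_iff: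
  assumes "u \<noteq> 0"
  shows "majorizes (u \<otimes>\<^sub>H v) (u \<otimes>\<^sub>H w) \<longleftrightarrow>
    (\<exists>M>0. \<forall>z. cmod \<langle>z, w\<rangle> \<le> M * cmod \<langle>z, v\<rangle>)"
  using assms by (simp add: majorizes_def rank_one.rep_eq norm_scaleC flip: mult.assoc)

section \<open>Spectral radius algebra of a rank-one operator\<close>

text \<open>The difference of \<open>w\<close> and its projection onto \<open>v\<close> is
  orthogonal to \<open>v\<close>, hence to \<open>w\<close>, hence to itself.\<close>

lemma eigenvector_if_orthogonal_complement_subset:
  fixes v w :: "'a::complex_hilbert"
  assumes "v \<noteq> 0" "\<And>z. \<langle>z, v\<rangle> = 0 \<Longrightarrow> \<langle>z, w\<rangle> = 0"
  shows "w = (\<langle>w, v\<rangle> / \<langle>v, v\<rangle>) *\<^sub>C v"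
proof -
  define z where "z = w - (\<langle>w, v\<rangle> / \<langle>v, v\<rangle>) *\<^sub>C v"
  have zv: "\<langle>z, v\<rangle> = 0"
    using \<open>v \<noteq> 0\<close> by (simp add: z_def cinner_linear_simps cinner_self)
  have "\<langle>z, z\<rangle> = \<langle>z, w\<rangle> - cnj (\<langle>w, v\<rangle> / \<langle>v, v\<rangle>) * \<langle>z, v\<rangle>"
    by (subst (2) z_def) (simp only: cinner_linear_simps)
  then have "\<langle>z, z\<rangle> = 0" using assms(2)[OF zv] zv by simp
  then show ?thesis by (simp add: z_def cinner_self)
qed

text \<open>The bound is uniform in \<open>t\<close>: writing \<open>h = R g\<close>, the
  eigenvector condition turns the only term of \<open>R (S g)\<close> containing \<open>t\<close>
  into \<open>cnj l *\<^sub>C (h - g)\<close>.\<close>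

lemma norm_conjugate_id_plus_rank_one_le:
  fixes v :: "'a::complex_hilbert"
  assumes S: "S \<in> bounded_ops" and eig: "op_adj S v = l *\<^sub>C v" and "0 \<le> t"
    and R: "R = id_blinfun + t *\<^sub>R (v \<otimes>\<^sub>H v)"
  shows "norm (R o\<^sub>L S o\<^sub>L op_inv R) \<le> norm S + 2 * cmod l"
proof (rule norm_blinfun_bound)
  fix h
  define g where "g = op_inv R h"
  have Rg: "R g = h"
    unfolding g_def R by (intro op_inv_apply(2) op_invertible_id_plus_rank_one \<open>0 \<le> t\<close>)
  have "R g = g + (of_real t * \<langle>g, v\<rangle>) *\<^sub>C v"
    by (simp add: R blinfun.bilinear_simps rank_one.rep_eq scaleR_eq_scaleC)
  then have hg: "h - g = (of_real t * \<langle>g, v\<rangle>) *\<^sub>C v"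
    by (simp add: Rg)
  have "R (S g) = S g + (of_real t * (cnj l * \<langle>g, v\<rangle>)) *\<^sub>C v"
    by (simp add: R blinfun.bilinear_simps rank_one.rep_eq scaleR_eq_scaleC
        cinner_op_adj[OF S] eig cinner_scaleC_right)
  then have RS: "R (S g) = S g + cnj l *\<^sub>C (h - g)"
    by (simp add: hg mult_ac)
  \<comment> \<open>The inverse of \<open>R\<close> is a contraction, because
    \<open>\<langle>R g, g\<rangle>\<close> is at least \<open>(norm g)\<^sup>2\<close>.\<close>
  have gh: "norm g \<le> norm h"
  proof -
    have "\<langle>h, g\<rangle> = of_real ((norm g)\<^sup>2 + t * (cmod \<langle>g, v\<rangle>)\<^sup>2)"
      using cinner_commute[of v g] unfolding Rg[symmetric]
      by (simp add: R blinfun.bilinear_simps rank_one.rep_eq cinner_linear_simps cinner_self cmod_mult_cnj)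
    then have "(norm g)\<^sup>2 \<le> Re \<langle>h, g\<rangle>"
      using \<open>0 \<le> t\<close> by simp
    also have "\<dots> \<le> norm h * norm g"
      using cinner_Cauchy_Schwarz[of h g] complex_Re_le_cmod[of "\<langle>h, g\<rangle>"] by linarith
    finally show ?thesis
      by (cases "g = 0") (simp_all add: power2_eq_square)
  qed
  have "norm (S g) \<le> norm S * norm h"
    using norm_blinfun[of S g] mult_left_mono[OF gh norm_ge_zero[of S]] by linarith
  moreover have "norm (h - g) \<le> 2 * norm h"
    using norm_triangle_ineq4[of h g] gh by linarith
  then have "norm (cnj l *\<^sub>C (h - g)) \<le> cmod l * (2 * norm h)"
    by (simp add: norm_scaleC mult_left_mono)
  ultimately show "norm ((R o\<^sub>L S o\<^sub>L op_inv R) h) \<le> (norm S + 2 * cmod l) * norm h"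
    using norm_triangle_ineq[of "S g" "cnj l *\<^sub>C (h - g)"]
    by (simp add: RS flip: g_def) (simp add: algebra_simps)
qed simp

text \<open>Both \<open>R\<close> and its inverse fix \<open>w\<close>, whereas the component of
  \<open>S w\<close> along \<open>v\<close> is amplified by
  \<open>1 + t * (norm v)\<^sup>2\<close>.\<close>

lemma cmod_le_norm_conjugate_id_plus_rank_one:
  fixes v w :: "'a::complex_hilbert" and S :: "'a \<Rightarrow>\<^sub>L 'a"
  assumes "0 \<le> t" and R: "R = id_blinfun + t *\<^sub>R (v \<otimes>\<^sub>H v)" and w: "\<langle>w, v\<rangle> = 0"
  shows "(1 + t * (norm v)\<^sup>2) * cmod \<langle>S w, v\<rangle> \<le> norm (R o\<^sub>L S o\<^sub>L op_inv R) * norm w * norm v"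
proof -
  have "R w = w"
    using w by (simp add: R blinfun.bilinear_simps rank_one.rep_eq)
  then have inv: "op_inv R w = w"
    using op_invertible_id_plus_rank_one[OF \<open>0 \<le> t\<close>, of v] op_inv_apply(1)[of R w] by (simp add: R)
  have "\<langle>R (S w), v\<rangle> = of_real (1 + t * (norm v)\<^sup>2) * \<langle>S w, v\<rangle>"
    by (simp add: R blinfun.bilinear_simps rank_one.rep_eq cinner_linear_simps cinner_self algebra_simps)
  then have "(1 + t * (norm v)\<^sup>2) * cmod \<langle>S w, v\<rangle> = cmod \<langle>(R o\<^sub>L S o\<^sub>L op_inv R) w, v\<rangle>"
    using \<open>0 \<le> t\<close> by (simp add: inv norm_mult del: of_real_add of_real_mult)
  also have "\<dots> \<le> norm ((R o\<^sub>L S o\<^sub>L op_inv R) w) * norm v"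
    by (rule cinner_Cauchy_Schwarz)
  also have "\<dots> \<le> (norm (R o\<^sub>L S o\<^sub>L op_inv R) * norm w) * norm v"
    by (intro mult_right_mono norm_blinfun) simp
  finally show ?thesis .
qed

lemma spectral_radius_algebra_rank_one:
  fixes u v :: "'a::complex_hilbert"
  assumes "u \<noteq> 0" "v \<noteq> 0"
  shows "spectral_radius_algebra (u \<otimes>\<^sub>H v) = {S \<in> bounded_ops. op_eigenvector (op_adj S) v}"
proof -
  let ?R = "sra_R (u \<otimes>\<^sub>H v)"
  let ?b = "\<lambda>S m. norm (?R m o\<^sub>L S o\<^sub>L op_inv (?R m))"
  have "bdd_above (?b S ` {1..}) \<longleftrightarrow> op_eigenvector (op_adj S) v" if S: "S \<in> bounded_ops" for S
  proof
    assume "op_eigenvector (op_adj S) v"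
    then obtain l where l: "op_adj S v = l *\<^sub>C v" by (auto simp: op_eigenvector_def)
    have "?b S m \<le> norm S + 2 * cmod l" if "1 \<le> m" for m
      using sra_R_rank_one[OF assms that] norm_conjugate_id_plus_rank_one_le[OF S l] by metis
    then show "bdd_above (?b S ` {1..})" by (intro bdd_aboveI2) auto
  next
    assume "bdd_above (?b S ` {1..})"
    then obtain M where M: "\<And>m. 1 \<le> m \<Longrightarrow> ?b S m \<le> M"
      by (auto simp: bdd_above_def)
    have "\<langle>w, op_adj S v\<rangle> = 0" if w: "\<langle>w, v\<rangle> = 0" for w
    proof (rule ccontr)
      assume "\<langle>w, op_adj S v\<rangle> \<noteq> 0"
      then have nz: "0 < cmod \<langle>S w, v\<rangle>"
        by (simp add: cinner_op_adj[OF S])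
      \<comment> \<open>Squaring the amplification estimate and inserting the growth bound from
        \<open>sra_R_rank_one\<close> yields \<open>real m * C \<le> D\<close> for all
        \<open>m \<ge> 1\<close>, which is impossible for \<open>C > 0\<close>.\<close>
      define C where "C = (norm u)\<^sup>2 * (norm v)\<^sup>2 * (cmod \<langle>S w, v\<rangle>)\<^sup>2"
      define D where "D = (1 + 2 * cmod \<langle>u, v\<rangle>) * (M * norm w * norm v)\<^sup>2"
      have "0 < C" using nz assms by (simp add: C_def)
      have le: "real m * C \<le> D" if m: "1 \<le> m" for m
      proof -
        obtain t where t: "0 \<le> t" "?R m = id_blinfun + t *\<^sub>R (v \<otimes>\<^sub>H v)"
          "real m * (norm u)\<^sup>2 * (norm v)\<^sup>2 \<le> (1 + 2 * cmod \<langle>u, v\<rangle>) * (1 + t * (norm v)\<^sup>2)\<^sup>2"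
          by (rule sra_R_rank_one[OF assms m])
        have "(1 + t * (norm v)\<^sup>2) * cmod \<langle>S w, v\<rangle> \<le> ?b S m * norm w * norm v"
          by (rule cmod_le_norm_conjugate_id_plus_rank_one[OF t(1,2) w])
        also have "\<dots> \<le> M * norm w * norm v"
          using M[OF m] by (intro mult_right_mono) auto
        finally have "((1 + t * (norm v)\<^sup>2) * cmod \<langle>S w, v\<rangle>)\<^sup>2 \<le> (M * norm w * norm v)\<^sup>2"
          using t(1) by (intro power_mono) auto
        then have "(1 + 2 * cmod \<langle>u, v\<rangle>) * ((1 + t * (norm v)\<^sup>2) * cmod \<langle>S w, v\<rangle>)\<^sup>2 \<le> D"
          unfolding D_def by (intro mult_left_mono) auto
        moreover have "real m * C \<le>
            (1 + 2 * cmod \<langle>u, v\<rangle>) * ((1 + t * (norm v)\<^sup>2) * cmod \<langle>S w, v\<rangle>)\<^sup>2"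
          using mult_right_mono[OF t(3), of "(cmod \<langle>S w, v\<rangle>)\<^sup>2"]
          by (simp add: C_def power_mult_distrib mult_ac)
        ultimately show ?thesis by linarith
      qed
      \<comment> \<open>The Archimedean \<open>m\<close> might be 0, so the contradiction is drawn
        at \<open>Suc m\<close>.\<close>
      obtain m where m: "D / C < real m" using reals_Archimedean2 by blast
      then have "D < real m * C" using \<open>0 < C\<close> by (simp add: field_simps)
      moreover have "real m * C \<le> real (Suc m) * C"
        using \<open>0 < C\<close> by (intro mult_right_mono) auto
      ultimately show False using le[of "Suc m"] by simp
    qed
    then show "op_eigenvector (op_adj S) v"
      using eigenvector_if_orthogonal_complement_subset[OF \<open>v \<noteq> 0\<close>] \<open>v \<noteq> 0\<close>
      unfolding op_eigenvector_def by blast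
  qed
  then show ?thesis
    unfolding spectral_radius_algebra_def by (intro Collect_cong conj_cong refl)
qed

section \<open>Transfer along the similarity\<close>

text \<open>Cancelling \<open>A\<close> in the similarity makes \<open>T\<close> a rank-one
  operator. If \<open>x = 0\<close>, both operators in the majorization vanish, so it holds for
  every \<open>S\<close>; if \<open>y = 0\<close>, no operator has \<open>op_adj A y\<close> as an
  eigenvector, although the zero operator lies in the spectral radius algebra.\<close>

theorem proposition2p4:
  fixes T A :: "'a::complex_hilbert \<Rightarrow>\<^sub>L 'a" and x y :: 'a
  assumes "T \<in> bounded_ops" and "A \<in> bounded_ops" and "op_invertible A"
    and "A o\<^sub>L T = (x \<otimes>\<^sub>H y) o\<^sub>L A"
  shows "(\<forall>S\<in>bounded_ops.
      (S \<in> deddens_algebra T \<longleftrightarrow>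
        majorizes (op_inv A x \<otimes>\<^sub>H op_adj A y) (op_inv A x \<otimes>\<^sub>H op_adj S (op_adj A y))) \<and>
      (x \<noteq> 0 \<longrightarrow>
        (majorizes (op_inv A x \<otimes>\<^sub>H op_adj A y) (op_inv A x \<otimes>\<^sub>H op_adj S (op_adj A y)) \<longleftrightarrow>
         (\<exists>M>0. \<forall>z. cmod \<langle>z, op_adj S (op_adj A y)\<rangle> \<le> M * cmod \<langle>z, op_adj A y\<rangle>)))) \<and>
    (x \<noteq> 0 \<and> y \<noteq> 0 \<longrightarrow>
      spectral_radius_algebra T = {S \<in> bounded_ops. op_eigenvector (op_adj S) (op_adj A y)})"
proof -
  note inv = op_inv_apply[OF assms(3)]
  have T: "T = op_inv A x \<otimes>\<^sub>H op_adj A y"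
  proof (rule blinfun_eqI)
    fix h
    have "A (T h) = \<langle>A h, y\<rangle> *\<^sub>C x"
      using assms(4) by (metis blinfun_apply_blinfun_compose rank_one.rep_eq)
    then have "T h = op_inv A (\<langle>A h, y\<rangle> *\<^sub>C x)"
      by (metis inv(1))
    then show "T h = (op_inv A x \<otimes>\<^sub>H op_adj A y) h"
      using bounded_ops_scaleC[OF op_invertible_op_inv(1)[OF assms(3)]]
      by (simp add: rank_one.rep_eq cinner_op_adj[OF assms(2)])
  qed
  have u: "op_inv A x \<noteq> 0" if "x \<noteq> 0"
    using that inv(2)[of x] by (metis blinfun.zero_right)
  have v: "op_adj A y \<noteq> 0" if "y \<noteq> 0"
  proof
    assume "op_adj A y = 0"
    \<comment> \<open>The first \<open>y\<close> is written as \<open>A (op_inv A y)\<close>, and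
      \<open>A\<close> is moved to the other side.\<close>
    then have "\<langle>y, y\<rangle> = 0"
      using cinner_op_adj[OF assms(2), of "op_inv A y" y] by (simp add: inv(2))
    then show False using that by (simp add: cinner_self)
  qed
  show ?thesis
    unfolding T
    by (intro conjI ballI impI deddens_algebra_rank_one_iff majorizes_rank_one_iff
        spectral_radius_algebra_rank_one) (use u v in auto)
qed

end
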